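(* Let $\mathcal C$ be a class of languages that is a full semi-AFL, let $G$ be a finitely generated virtually abelian group, and let $\bullet$ denote either $\forall$ or $\exists$. If $U$ is a subset of $G$ with $U\in\mathcal C^{\bullet}(G)$, then $\alpha(U)\in\mathcal C^{\bullet}(G)$.
   Context: A class of languages $\mathcal C$ is a cone if it is closed under homomorphisms (of free monoids of finite rank), inverse homomorphisms, and intersections with regular languages; a full semi-AFL is a cone that is also closed under (finite) unions. Let $G$ be a group with finite generating set $X$, $\widetilde X=X\cup X^{-1}$, and $\pi:\widetilde X^*\to G$ the canonical surjective monoid homomorphism. For $S\subseteq G$: $S\in\mathcal C^{\forall}(G)$ means $S\pi^{-1}\in\mathcal C$ (where $S\pi^{-1}\subseteq\widetilde X^*$ is the full preimage of $S$); $S\in\mathcal C^{\exists}(G)$ means that there is $L\in\mathcal C$, $L\subseteq\widetilde X^*$, with $L\pi=S$. For $U\subseteq G$, $\alpha(U)=\bigcup_{g\in G}g^{-1}Ug$. The symbol $\bullet$ has the same value in hypothesis and conclusion. *)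

theory Defs
  imports "HOL-Algebra.Generated_Groups"
begin

text \<open>Letters are taken from the countable stock \<^typ>\<open>nat\<close>: a finite alphabet is a finite
  set of naturals, the free monoid on \<open>A\<close> is \<^term>\<open>lists A\<close>, and a class of languages is a set of
  languages, each over some finite alphabet.  The homomorphism of free monoids determined by
  \<open>h\<close> on letters is \<open>word_hom h\<close>; its values on letters outside the alphabet of the language
  at hand are irrelevant.\<close>

definition word_hom :: "('a \<Rightarrow> 'b list) \<Rightarrow> 'a list \<Rightarrow> 'b list" where
  "word_hom h w = concat (map h w)"

definition regular_language :: "nat list set \<Rightarrow> bool" where
  "regular_language L \<longleftrightarrow>
     (\<exists>A (Q :: nat set) q0 \<delta> F.
        finite A \<and> finite Q \<and> q0 \<in> Q \<and> F \<subseteq> Q \<and> (\<forall>q\<in>Q. \<forall>a\<in>A. \<delta> q a \<in> Q) \<and>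
        L = {w \<in> lists A. foldl \<delta> q0 w \<in> F})"

definition language_class :: "nat list set set \<Rightarrow> bool" where
  "language_class C \<longleftrightarrow> (\<forall>L\<in>C. \<exists>A. finite A \<and> L \<subseteq> lists A)"

definition lang_cone :: "nat list set set \<Rightarrow> bool" where
  "lang_cone C \<longleftrightarrow> language_class C \<and>
     (\<forall>L\<in>C. \<forall>h. word_hom h ` L \<in> C) \<and>
     (\<forall>L\<in>C. \<forall>A h. finite A \<longrightarrow> {w \<in> lists A. word_hom h w \<in> L} \<in> C) \<and>
     (\<forall>L\<in>C. \<forall>R. regular_language R \<longrightarrow> L \<inter> R \<in> C)"

definition full_semi_AFL :: "nat list set set \<Rightarrow> bool" where
  "full_semi_AFL C \<longleftrightarrow> lang_cone C \<and> (\<forall>L\<in>C. \<forall>K\<in>C. L \<union> K \<in> C)"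

text \<open>Membership in \<open>C\<close> of a language over an arbitrary finite alphabet \<open>A\<close>, such as a subset of a
  group: rename the letters injectively.  For a cone the choice of renaming does not matter, by
  \<open>renaming_independent\<close> below.\<close>

definition in_class :: "nat list set set \<Rightarrow> 'a set \<Rightarrow> 'a list set \<Rightarrow> bool" where
  "in_class C A L \<longleftrightarrow> L \<subseteq> lists A \<and> (\<exists>e. inj_on e A \<and> map e ` L \<in> C)"

lemma renaming_independent:
  assumes "lang_cone C" "inj_on e A" "L \<subseteq> lists A" "map e ` L \<in> C"
  shows "map e' ` L \<in> C"
proof -
  define h where "h n = [e' (inv_into A e n)]" for n
  have "word_hom h (map e w) = map e' w" if "w \<in> lists A" for w
    using that assms(2) by (induction w) (auto simp: word_hom_def h_def)
  with assms(3) have "word_hom h ` map e ` L = map e' ` L"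
    by (force simp: image_image intro!: image_cong)
  with assms(1,4) show ?thesis
    unfolding lang_cone_def by metis
qed

definition sym_gens :: "('a, 'b) monoid_scheme \<Rightarrow> 'a set \<Rightarrow> 'a set" where
  "sym_gens G Gen = Gen \<union> (\<lambda>x. inv\<^bsub>G\<^esub> x) ` Gen"

definition word_eval :: "('a, 'b) monoid_scheme \<Rightarrow> 'a list \<Rightarrow> 'a" where
  "word_eval G w = foldr (\<lambda>x y. x \<otimes>\<^bsub>G\<^esub> y) w \<one>\<^bsub>G\<^esub>"

definition class_forall ::
    "nat list set set \<Rightarrow> ('a, 'b) monoid_scheme \<Rightarrow> 'a set \<Rightarrow> 'a set set" where
  "class_forall C G Gen =
     {S. S \<subseteq> carrier G \<and>
         in_class C (sym_gens G Gen) {w \<in> lists (sym_gens G Gen). word_eval G w \<in> S}}"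

definition class_exists ::
    "nat list set set \<Rightarrow> ('a, 'b) monoid_scheme \<Rightarrow> 'a set \<Rightarrow> 'a set set" where
  "class_exists C G Gen =
     {S. S \<subseteq> carrier G \<and>
         (\<exists>L. in_class C (sym_gens G Gen) L \<and> word_eval G ` L = S)}"

definition conj_closure :: "('a, 'b) monoid_scheme \<Rightarrow> 'a set \<Rightarrow> 'a set" where
  "conj_closure G U =
     (\<Union>g\<in>carrier G. (\<lambda>u. inv\<^bsub>G\<^esub> g \<otimes>\<^bsub>G\<^esub> u \<otimes>\<^bsub>G\<^esub> g) ` U)"

definition virtually_abelian :: "('a, 'b) monoid_scheme \<Rightarrow> bool" where
  "virtually_abelian G \<longleftrightarrow>
     (\<exists>H. subgroup H G \<and> finite (rcosets\<^bsub>G\<^esub> H) \<and> comm_group (G\<lparr>carrier := H\<rparr>))"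

end

theory Submission
  imports Defs
begin

text \<open>Let \<open>N\<close> be an abelian normal subgroup of finite index and \<open>T\<close> a finite transversal.  For
  \<open>x \<in> N t\<close> and \<open>m \<in> N\<close> one has \<open>m\<inverse> x m = x k\<close> with \<open>k = t\<inverse> m\<inverse> t m\<close>, which depends on the coset
  of \<open>x\<close> only, and \<open>m \<mapsto> k\<close> is a homomorphism on \<open>N\<close>.  Hence the conjugates of \<open>x\<close> are the elements
  \<open>s\<inverse> x k s\<close> with \<open>s \<in> T\<close> and \<open>k\<close> in a finitely generated subgroup \<open>K\<^sub>t\<close>, the image of a finitely
  generated submonoid of words.  For \<open>\<exists>\<close>, restrict a language for \<open>U\<close> to each coset \<open>N t\<close> (a regular
  condition) and attach words for \<open>s\<inverse>\<close>, \<open>K\<^sub>t\<close> and \<open>s\<close>; for \<open>\<forall>\<close>, strip these words from the full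
  preimage of \<open>U\<close> and then restrict to \<open>N t\<close>.  Cones are closed under both operations, and finitely
  many pairs \<open>(s, t)\<close> suffice.\<close>

section \<open>Cone operations over arbitrary finite alphabets\<close>

lemma word_hom_simps [simp]:
  "word_hom h [] = []"
  "word_hom h (a # w) = h a @ word_hom h w"
  "word_hom h (v @ w) = word_hom h v @ word_hom h w"
  by (simp_all add: word_hom_def)

lemma word_hom_in_lists: "w \<in> lists A \<Longrightarrow> h ` A \<subseteq> lists B \<Longrightarrow> word_hom h w \<in> lists B"
  by (induction w) auto

lemma concat_in_lists: "y \<in> lists K \<Longrightarrow> K \<subseteq> lists A \<Longrightarrow> concat y \<in> lists A"
  by (induction y) auto

lemma ex_inj_on_nat: "finite A \<Longrightarrow> \<exists>e :: 'a \<Rightarrow> nat. inj_on e A"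
  using finite_imp_inj_to_nat_seg by blast

text \<open>The cone axioms speak of letters in \<open>nat\<close> only. Conjugating
  \<open>h\<close> by two renamings, with \<open>inv_into A e\<close> undoing the first, carries
  them over to alphabets of any type.\<close>

lemma word_hom_renamed:
  assumes "inj_on e A" "w \<in> lists A"
  shows "word_hom (\<lambda>n. map e' (h (inv_into A e n))) (map e w) = map e' (word_hom h w)"
  using assms(2) by (induction w) (simp_all add: assms(1))

lemma in_class_word_hom:
  assumes "lang_cone C" "in_class C A L" "finite B" "h ` A \<subseteq> lists B"
  shows "in_class C B (word_hom h ` L)"
proof -
  obtain e where e: "inj_on e A" "map e ` L \<in> C" and L: "L \<subseteq> lists A"
    using assms(2) unfolding in_class_def by blast
  obtain e' :: "'b \<Rightarrow> nat" where e': "inj_on e' B"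
    using ex_inj_on_nat[OF assms(3)] by blast
  let ?h = "\<lambda>n. map e' (h (inv_into A e n))"
  have "word_hom ?h ` map e ` L = map e' ` word_hom h ` L"
    unfolding image_image using L by (intro image_cong refl word_hom_renamed[OF e(1)]) blast
  moreover have "word_hom ?h ` map e ` L \<in> C"
    using assms(1) e(2) unfolding lang_cone_def by blast
  ultimately have "map e' ` word_hom h ` L \<in> C" by simp
  moreover have "word_hom h ` L \<subseteq> lists B"
    using L word_hom_in_lists[OF _ assms(4)] by blast
  ultimately show ?thesis
    using e' unfolding in_class_def by blast
qed

lemma in_class_vimage_word_hom:
  assumes "lang_cone C" "in_class C A L" "finite B" "h ` B \<subseteq> lists A"
  shows "in_class C B {w \<in> lists B. word_hom h w \<in> L}"
proof -
  obtain e where e: "inj_on e A" "map e ` L \<in> C" and L: "L \<subseteq> lists A"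
    using assms(2) unfolding in_class_def by blast
  obtain e' :: "'b \<Rightarrow> nat" where e': "inj_on e' B"
    using ex_inj_on_nat[OF assms(3)] by blast
  let ?h = "\<lambda>n. map e (h (inv_into B e' n))"
  \<comment> \<open>Injectivity of \<open>e\<close> on \<open>A\<close> extends to
    \<open>lists A\<close>, so a renamed word lies in the renamed \<open>L\<close> only if the word
    itself lies in \<open>L\<close>.\<close>
  have iff: "word_hom ?h (map e' w) \<in> map e ` L \<longleftrightarrow> word_hom h w \<in> L" if "w \<in> lists B" for w
  proof -
    have "word_hom h w \<in> lists A"
      using word_hom_in_lists[OF that assms(4)] .
    then show ?thesis
      unfolding word_hom_renamed[OF e' that]
      using inj_on_image_mem_iff[OF inj_on_map_lists[OF e(1)]] L by blast
  qed
  have "{w \<in> lists (e' ` B). word_hom ?h w \<in> map e ` L} = map e' ` {w \<in> lists B. word_hom h w \<in> L}"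
    unfolding lists_image using iff by blast
  moreover have "{w \<in> lists (e' ` B). word_hom ?h w \<in> map e ` L} \<in> C"
    using assms(1,3) e(2) unfolding lang_cone_def by blast
  ultimately show ?thesis
    using e' unfolding in_class_def by auto
qed

lemma in_class_Int_automaton:
  assumes "lang_cone C" "in_class C A L" "finite A"
    and "finite Q" "q0 \<in> Q" "\<And>q a. q \<in> Q \<Longrightarrow> a \<in> A \<Longrightarrow> \<delta> q a \<in> Q"
  shows "in_class C A {w \<in> L. foldl \<delta> q0 w \<in> F}"
proof -
  obtain e where e: "inj_on e A" "map e ` L \<in> C" and L: "L \<subseteq> lists A"
    using assms(2) unfolding in_class_def by blast
  obtain f :: "'b \<Rightarrow> nat" where f: "inj_on f Q"
    using ex_inj_on_nat[OF assms(4)] by blast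
  define d where "d p n = f (\<delta> (inv_into Q f p) (inv_into A e n))" for p n
  have run: "foldl d (f q) (map e w) = f (foldl \<delta> q w) \<and> foldl \<delta> q w \<in> Q"
    if "w \<in> lists A" "q \<in> Q" for q w
    using that
    by (induction w arbitrary: q) (auto simp: d_def e(1) f assms(6))
  \<comment> \<open>\<open>F\<close> may contain values outside \<open>Q\<close>, where
    \<open>f\<close> need not be injective, hence the intersection with \<open>Q\<close>. By
    \<open>run\<close> every reached state stays in \<open>Q\<close>.\<close>
  let ?R = "{w \<in> lists (e ` A). foldl d (f q0) w \<in> f ` (F \<inter> Q)}"
  have "regular_language ?R"
    unfolding regular_language_def
    by (rule exI[of _ "e ` A"], rule exI[of _ "f ` Q"], rule exI[of _ "f q0"], rule exI[of _ d],
        rule exI[of _ "f ` (F \<inter> Q)"]) (use assms(3-6) in \<open>auto simp: d_def e(1) f\<close>)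
  then have "map e ` L \<inter> ?R \<in> C"
    using assms(1) e(2) unfolding lang_cone_def by blast
  moreover have "map e ` L \<inter> ?R = map e ` {w \<in> L. foldl \<delta> q0 w \<in> F}"
  proof -
    have "map e w \<in> ?R \<longleftrightarrow> foldl \<delta> q0 w \<in> F" if "w \<in> L" for w
    proof -
      have "w \<in> lists A" using that L by blast
      with run[OF this assms(5)] show ?thesis
        using f by (auto simp: inj_on_image_mem_iff[OF f])
    qed
    then show ?thesis by blast
  qed
  ultimately show ?thesis
    using e(1) L unfolding in_class_def by auto
qed

lemma in_class_Un:
  assumes "full_semi_AFL C" "in_class C A L" "in_class C A K"
  shows "in_class C A (L \<union> K)"
proof -
  have C: "lang_cone C" "\<And>L K. L \<in> C \<Longrightarrow> K \<in> C \<Longrightarrow> L \<union> K \<in> C"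
    using assms(1) by (auto simp: full_semi_AFL_def)
  obtain e where e: "inj_on e A" "map e ` L \<in> C"
    using assms(2) unfolding in_class_def by blast
  \<comment> \<open>The renaming that witnesses membership of \<open>K\<close> may differ from
    \<open>e\<close>; independence of the renaming puts both languages over the same
    letters.\<close>
  have "map e ` K \<in> C"
    using assms(3) renaming_independent[OF C(1)] unfolding in_class_def by blast
  with C(2)[OF e(2)] have "map e ` (L \<union> K) \<in> C"
    by (simp add: image_Un)
  with assms(2,3) e(1) show ?thesis
    unfolding in_class_def by auto
qed

text \<open>An empty union is excluded: \<open>C\<close> may be the empty class, which lacks even
  the empty language.\<close>

lemma in_class_UN:
  assumes "full_semi_AFL C" "finite I" "I \<noteq> {}" "\<And>i. i \<in> I \<Longrightarrow> in_class C A (L i)"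
  shows "in_class C A (\<Union>i\<in>I. L i)"
  using assms(2-4) by (induction I rule: finite_ne_induct) (auto intro: in_class_Un[OF assms(1)])

text \<open>The automaton \<open>step\<close> accepts the words of the form \<open>Pre Base\<^sup>* Loop\<^sup>* Post\<close>.  Such a word encodes
  \<open>x\<close> together with a factorisation of \<open>y \<in> K\<^sup>*\<close>; \<open>erase\<close> maps it to \<open>x\<close> and \<open>expand u v\<close> to
  \<open>u x y v\<close>, so that words of \<open>K\<^sup>*\<close> can be attached to a language or stripped from it.\<close>

datatype 'a letter = Pre | Base 'a | Loop "'a list" | Post

datatype phase = Init | Body | Tail | Done | Fail

fun step :: "phase \<Rightarrow> 'a letter \<Rightarrow> phase" where
  "step Init Pre = Body"
| "step Body (Base a) = Body"
| "step Body (Loop k) = Tail"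
| "step Body Post = Done"
| "step Tail (Loop k) = Tail"
| "step Tail Post = Done"
| "step _ _ = Fail"

lemma finite_UNIV_phase: "finite (UNIV :: phase set)"
  by (rule finite_subset[of _ "{Init, Body, Tail, Done, Fail}"]) (use phase.exhaust in auto)

text \<open>The accepted words are found backwards, one lemma per state, from the absorbing
  \<open>Fail\<close> and from \<open>Done\<close> to \<open>Init\<close>.\<close>

lemma run_Fail: "foldl step Fail w = Fail"
  by (induction w) auto

lemma run_Done: "foldl step Done w = Done \<longleftrightarrow> w = []"
  by (cases w) (auto simp: run_Fail)

lemma run_Tail: "foldl step Tail w = Done \<longleftrightarrow> (\<exists>y. w = map Loop y @ [Post])"
proof (induction w)
  case (Cons a w)
  have "(\<exists>y. Loop k # w = map Loop y @ [Post]) \<longleftrightarrow> (\<exists>y. w = map Loop y @ [Post])" for k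
  proof safe
    fix y assume "Loop k # w = map Loop y @ [Post]"
    then show "\<exists>y. w = map Loop y @ [Post]"
      by (cases y) auto
  next
    fix y
    show "\<exists>y'. Loop k # map Loop y @ [Post] = map Loop y' @ [Post]"
      by (intro exI[of _ "k # y"]) simp
  qed
  with Cons show ?case
    by (cases a) (auto simp: run_Fail run_Done Cons_eq_append_conv)
qed simp

lemma run_Body: "foldl step Body w = Done \<longleftrightarrow> (\<exists>x y. w = map Base x @ map Loop y @ [Post])"
proof (induction w)
  case (Cons a w)
  have "(\<exists>x y. Base b # w = map Base x @ map Loop y @ [Post]) \<longleftrightarrow>
      (\<exists>x y. w = map Base x @ map Loop y @ [Post])" for b
  proof safe
    fix x y assume "Base b # w = map Base x @ map Loop y @ [Post]"
    then show "\<exists>x y. w = map Base x @ map Loop y @ [Post]"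
    proof (cases x)
      case Nil
      with \<open>Base b # w = _\<close> show ?thesis by (cases y) auto
    qed auto
  next
    fix x y
    show "\<exists>x' y'. Base b # map Base x @ map Loop y @ [Post] = map Base x' @ map Loop y' @ [Post]"
      by (intro exI[of _ "b # x"] exI[of _ y]) simp
  qed
  moreover have "(\<exists>x y. Loop k # w = map Base x @ map Loop y @ [Post]) \<longleftrightarrow>
      (\<exists>y. w = map Loop y @ [Post])" for k
  proof safe
    fix x y assume "Loop k # w = map Base x @ map Loop y @ [Post]"
    then show "\<exists>y. w = map Loop y @ [Post]"
      by (cases x; cases y) auto
  next
    fix y
    show "\<exists>x' y'. Loop k # map Loop y @ [Post] = map Base x' @ map Loop y' @ [Post]"
      by (intro exI[of _ "[]"] exI[of _ "k # y"]) simp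
  qed
  ultimately show ?case
    using Cons by (cases a) (auto simp: run_Fail run_Done run_Tail Cons_eq_append_conv)
qed simp

lemma run_Init:
  "foldl step Init w = Done \<longleftrightarrow> (\<exists>x y. w = Pre # map Base x @ map Loop y @ [Post])"
proof (cases w)
  case (Cons a v)
  then show ?thesis
    by (cases a) (auto simp: run_Fail run_Body)
qed simp

fun erase :: "'a letter \<Rightarrow> 'a list" where
  "erase (Base a) = [a]"
| "erase _ = []"

fun expand :: "'a list \<Rightarrow> 'a list \<Rightarrow> 'a letter \<Rightarrow> 'a list" where
  "expand u v Pre = u"
| "expand u v (Base a) = [a]"
| "expand u v (Loop k) = k"
| "expand u v Post = v"

lemma word_hom_Base_Loop [simp]:
  "word_hom erase (map Base x) = x" "word_hom erase (map Loop y) = []"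
  "word_hom (expand u v) (map Base x) = x" "word_hom (expand u v) (map Loop y) = concat y"
  by (simp_all add: word_hom_def comp_def)

definition frame_letters :: "'a set \<Rightarrow> 'a list set \<Rightarrow> 'a letter set" where
  "frame_letters A K = {Pre, Post} \<union> Base ` A \<union> Loop ` K"

lemma framed_in_lists_iff:
  "Pre # map Base x @ map Loop y @ [Post] \<in> lists (frame_letters A K) \<longleftrightarrow>
    x \<in> lists A \<and> y \<in> lists K"
  by (auto simp: frame_letters_def)

lemma in_class_framed:
  assumes "lang_cone C" "finite A" "finite K"
    and "in_class C (frame_letters A K) L"
  shows "in_class C (frame_letters A K)
    (L \<inter> {Pre # map Base x @ map Loop y @ [Post] | x y. x \<in> lists A \<and> y \<in> lists K})"
proof -
  have "finite (frame_letters A K)"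
    using assms(2,3) by (simp add: frame_letters_def)
  then have "in_class C (frame_letters A K) {w \<in> L. foldl step Init w \<in> {Done}}"
    by (intro in_class_Int_automaton[OF assms(1,4) _ finite_UNIV_phase]) auto
  moreover have "L \<subseteq> lists (frame_letters A K)"
    using assms(4) by (simp add: in_class_def)
  \<comment> \<open>The automaton checks only the shape of a word; that its letters come from
    \<open>A\<close> and \<open>K\<close> follows from the alphabet of \<open>L\<close>.\<close>
  then have "{w \<in> L. foldl step Init w \<in> {Done}} =
      L \<inter> {Pre # map Base x @ map Loop y @ [Post] | x y. x \<in> lists A \<and> y \<in> lists K}"
    unfolding singleton_iff run_Init framed_in_lists_iff[symmetric] by blast
  ultimately show ?thesis by simp
qed

text \<open>Nivat's form of a rational transduction: pull \<open>L\<close> back along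
  \<open>erase\<close>, keep the framed words by a regular condition, push forward along
  \<open>expand u v\<close>. Each word of \<open>K\<close> is one letter of the frame alphabet,
  which is therefore finite.\<close>

lemma in_class_frame:
  assumes "lang_cone C" "in_class C A L" "finite A" "finite K"
    and "K \<subseteq> lists A" "u \<in> lists A" "v \<in> lists A"
  shows "in_class C A {u @ x @ concat y @ v | x y. x \<in> L \<and> y \<in> lists K}"
proof -
  let ?D = "frame_letters A K"
  let ?P = "{Pre # map Base x @ map Loop y @ [Post] | x y. x \<in> lists A \<and> y \<in> lists K}"
  have D: "finite ?D" "erase ` ?D \<subseteq> lists A" "expand u v ` ?D \<subseteq> lists A"
    using assms(3-7) by (auto simp: frame_letters_def)
  have L: "L \<subseteq> lists A"
    using assms(2) by (simp add: in_class_def)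
  have "word_hom (expand u v) ` ({w \<in> lists ?D. word_hom erase w \<in> L} \<inter> ?P) =
      {u @ x @ concat y @ v | x y. x \<in> L \<and> y \<in> lists K}" (is "?l = ?r")
  proof
    show "?l \<subseteq> ?r" by force
    show "?r \<subseteq> ?l"
    proof
      fix w assume "w \<in> ?r"
      then obtain x y where xy: "w = u @ x @ concat y @ v" "x \<in> L" "y \<in> lists K" by blast
      then have "x \<in> lists A" using L by blast
      with xy show "w \<in> ?l"
        by (intro image_eqI[of _ _ "Pre # map Base x @ map Loop y @ [Post]"])
          (auto simp: frame_letters_def)
    qed
  qed
  with in_class_word_hom[OF assms(1) in_class_framed[OF assms(1,3,4)
      in_class_vimage_word_hom[OF assms(1,2) D(1,2)]] assms(3) D(3)]
  show ?thesis by simp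
qed

text \<open>The inverse transduction: \<open>erase\<close> and \<open>expand u v\<close> change
  places. The existential quantifier over \<open>y\<close> arises from the image under
  \<open>erase\<close>, which forgets the \<open>Loop\<close> letters.\<close>

lemma in_class_unframe:
  assumes "lang_cone C" "in_class C A L" "finite A" "finite K"
    and "K \<subseteq> lists A" "u \<in> lists A" "v \<in> lists A"
  shows "in_class C A {x \<in> lists A. \<exists>y\<in>lists K. u @ x @ concat y @ v \<in> L}"
proof -
  let ?D = "frame_letters A K"
  let ?P = "{Pre # map Base x @ map Loop y @ [Post] | x y. x \<in> lists A \<and> y \<in> lists K}"
  have D: "finite ?D" "erase ` ?D \<subseteq> lists A" "expand u v ` ?D \<subseteq> lists A"
    using assms(3-7) by (auto simp: frame_letters_def)
  have "word_hom erase ` ({w \<in> lists ?D. word_hom (expand u v) w \<in> L} \<inter> ?P) =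
      {x \<in> lists A. \<exists>y\<in>lists K. u @ x @ concat y @ v \<in> L}" (is "?l = ?r")
  proof
    show "?l \<subseteq> ?r" by auto
    show "?r \<subseteq> ?l"
    proof
      fix x assume "x \<in> ?r"
      then obtain y where xy: "u @ x @ concat y @ v \<in> L" "x \<in> lists A" "y \<in> lists K" by blast
      then show "x \<in> ?l"
        by (intro image_eqI[of _ _ "Pre # map Base x @ map Loop y @ [Post]"])
          (auto simp: frame_letters_def)
    qed
  qed
  with in_class_word_hom[OF assms(1) in_class_framed[OF assms(1,3,4)
      in_class_vimage_word_hom[OF assms(1,2) D(1,3)]] assms(3) D(2)]
  show ?thesis by simp
qed

section \<open>Subgroups of finite index\<close>

context group
begin

lemma inv_mult_cancel_left [simp]:
  "x \<in> carrier G \<Longrightarrow> z \<in> carrier G \<Longrightarrow> inv x \<otimes> (x \<otimes> z) = z"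
  "x \<in> carrier G \<Longrightarrow> z \<in> carrier G \<Longrightarrow> x \<otimes> (inv x \<otimes> z) = z"
  by (simp_all flip: m_assoc)

section \<open>Evaluation of words in a group\<close>

lemma word_eval_simps [simp]:
  "word_eval G [] = \<one>"
  "word_eval G (a # w) = a \<otimes> word_eval G w"
  by (simp_all add: word_eval_def)

lemma word_eval_closed [simp]: "w \<in> lists (carrier G) \<Longrightarrow> word_eval G w \<in> carrier G"
  by (induction w) auto

lemma word_eval_append [simp]:
  "v \<in> lists (carrier G) \<Longrightarrow> w \<in> lists (carrier G) \<Longrightarrow>
    word_eval G (v @ w) = word_eval G v \<otimes> word_eval G w"
  by (induction v) (auto simp: m_assoc)

lemma word_eval_concat:
  "y \<in> lists (lists (carrier G)) \<Longrightarrow> word_eval G (concat y) = word_eval G (map (word_eval G) y)"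
proof (induction y)
  case (Cons k y)
  then have "concat y \<in> lists (carrier G)" by (intro concat_in_lists) auto
  with Cons show ?case by auto
qed simp

lemma word_eval_in_subgroup: "subgroup N G \<Longrightarrow> w \<in> lists N \<Longrightarrow> word_eval G w \<in> N"
  by (induction w) (auto simp: subgroup.m_closed subgroup.one_closed)

lemma sym_gens_closed: "Gen \<subseteq> carrier G \<Longrightarrow> sym_gens G Gen \<subseteq> carrier G"
  by (auto simp: sym_gens_def)

lemma word_eval_surj:
  assumes "Gen \<subseteq> carrier G" "generate G Gen = carrier G"
  shows "word_eval G ` lists (sym_gens G Gen) = carrier G"
proof
  have sub: "lists (sym_gens G Gen) \<subseteq> lists (carrier G)"
    using sym_gens_closed[OF assms(1)] by blast
  then show "word_eval G ` lists (sym_gens G Gen) \<subseteq> carrier G"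
    by (blast intro: word_eval_closed)
  have "g \<in> word_eval G ` lists (sym_gens G Gen)" if "g \<in> generate G Gen" for g
    using that
  proof induction
    case one
    show ?case by (rule image_eqI[of _ _ "[]"]) auto
  next
    case (incl h)
    then show ?case using assms(1)
      by (intro image_eqI[of _ _ "[h]"]) (auto simp: sym_gens_def)
  next
    case (inv h)
    then show ?case using assms(1)
      by (intro image_eqI[of _ _ "[inv h]"]) (auto simp: sym_gens_def)
  next
    case (eng h1 h2)
    then obtain v w where "v \<in> lists (sym_gens G Gen)" "w \<in> lists (sym_gens G Gen)"
      "h1 = word_eval G v" "h2 = word_eval G w" by blast
    moreover from this have "v \<in> lists (carrier G)" "w \<in> lists (carrier G)"
      using sub by blast+
    ultimately show ?case by (intro image_eqI[of _ _ "v @ w"]) auto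
  qed
  then show "carrier G \<subseteq> word_eval G ` lists (sym_gens G Gen)"
    using assms(2) by blast
qed

text \<open>The kernel of the action by right translation on the cosets of \<open>H\<close> fixes
  the coset \<open>H\<close> itself, hence lies in \<open>H\<close>; its cosets inject into the
  self-maps of the finite set \<open>rcosets H\<close>.\<close>

lemma finite_index_normal_core:
  assumes H: "subgroup H G" and fin: "finite (rcosets H)"
  obtains N where "N \<lhd> G" "N \<subseteq> H" "finite (rcosets N)"
proof -
  have HG: "H \<subseteq> carrier G" using H by (rule subgroup.subset)
  have rc: "c \<subseteq> carrier G" if "c \<in> rcosets H" for c
    using that subgroup.rcosets_carrier[OF H group_axioms] by blast
  have shift: "c #> x \<in> rcosets H" if "c \<in> rcosets H" "x \<in> carrier G" for c x
    using that HG by (auto simp: RCOSETS_def coset_mult_assoc)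
  \<comment> \<open>the kernel of the permutation action on the cosets\<close>
  define N where "N = {n \<in> carrier G. \<forall>c \<in> rcosets H. c #> n = c}"
  have sub: "subgroup N G"
  proof (rule subgroupI)
    show "N \<noteq> {}" using rc by (auto simp: N_def intro!: exI[of _ \<one>])
    fix a assume a: "a \<in> N"
    have "c #> inv a = c" if "c \<in> rcosets H" for c
      using a that coset_mult_assoc[OF rc[OF that], of a "inv a"] rc[OF that] by (simp add: N_def)
    then show "inv a \<in> N" using a by (simp add: N_def)
    fix b assume b: "b \<in> N"
    have "c #> (a \<otimes> b) = c" if "c \<in> rcosets H" for c
      using a b that rc by (simp add: N_def flip: coset_mult_assoc)
    then show "a \<otimes> b \<in> N" using a b by (simp add: N_def)
  qed (auto simp: N_def)
  have "x \<otimes> n \<otimes> inv x \<in> N" if x: "x \<in> carrier G" and n: "n \<in> N" for x n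
  proof -
    have "c #> (x \<otimes> n \<otimes> inv x) = c" if c: "c \<in> rcosets H" for c
    proof -
      have "c #> (x \<otimes> n \<otimes> inv x) = ((c #> x) #> n) #> inv x"
        using x subsetD[OF subgroup.subset[OF sub] n] rc[OF c] by (simp add: coset_mult_assoc m_assoc)
      also have "\<dots> = (c #> x) #> inv x"
        using n shift[OF c x] by (simp add: N_def)
      also have "\<dots> = c" using c rc x by (simp add: coset_mult_assoc)
      finally show ?thesis .
    qed
    then show ?thesis using x n by (simp add: N_def)
  qed
  with sub have "N \<lhd> G" by (simp add: normal_inv_iff)
  moreover have "N \<subseteq> H"
  proof
    fix n assume "n \<in> N"
    moreover have "H \<in> rcosets H" using rcosetsI[OF HG one_closed] HG by simp
    ultimately show "n \<in> H" using coset_join1[OF _ _ H] by (auto simp: N_def)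
  qed
  moreover have "finite (rcosets N)"
  proof -
    define \<rho> where "\<rho> x = (\<lambda>c\<in>rcosets H. c #> x)" for x
    have "\<rho> ` carrier G \<subseteq> rcosets H \<rightarrow>\<^sub>E rcosets H"
      using shift by (auto simp: \<rho>_def)
    then have "finite (\<rho> ` carrier G)"
      by (rule finite_subset) (simp add: fin finite_PiE)
    \<comment> \<open>If \<open>x\<close> and \<open>y\<close> permute the cosets alike, then
      \<open>x \<otimes> inv y\<close> acts trivially, so each coset of \<open>N\<close> is
      determined by a value of \<open>\<rho>\<close>.\<close>
    moreover have eq: "N #> x = N #> y"
      if x: "x \<in> carrier G" and y: "y \<in> carrier G" and xy: "\<rho> x = \<rho> y" for x y
    proof -
      have "c #> (x \<otimes> inv y) = c" if c: "c \<in> rcosets H" for c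
      proof -
        have "c #> x = c #> y" using xy c by (auto simp: \<rho>_def restrict_def fun_eq_iff split: if_splits)
        then have "c #> (x \<otimes> inv y) = (c #> y) #> inv y"
          using x y rc[OF c] by (simp flip: coset_mult_assoc)
        then show ?thesis using y rc[OF c] by (simp add: coset_mult_assoc)
      qed
      then have "x \<otimes> inv y \<in> N" using x y by (simp add: N_def)
      then have "N #> (x \<otimes> inv y) = N" using sub x y by (simp add: coset_join2)
      then show ?thesis using x y subgroup.subset[OF sub] by (rule coset_mult_inv1)
    qed
    have "rcosets N \<subseteq> (\<lambda>f. N #> inv_into (carrier G) \<rho> f) ` \<rho> ` carrier G"
    proof
      fix c assume "c \<in> rcosets N"
      then obtain x where x: "x \<in> carrier G" "c = N #> x" by (auto simp: RCOSETS_def)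
      have "inv_into (carrier G) \<rho> (\<rho> x) \<in> carrier G" "\<rho> (inv_into (carrier G) \<rho> (\<rho> x)) = \<rho> x"
        using x by (auto intro: inv_into_into f_inv_into_f)
      then have "c = N #> inv_into (carrier G) \<rho> (\<rho> x)" using eq x by metis
      then show "c \<in> (\<lambda>f. N #> inv_into (carrier G) \<rho> f) ` \<rho> ` carrier G" using x by blast
    qed
    ultimately show ?thesis by (meson finite_imageI finite_subset)
  qed
  ultimately show thesis by (rule that)
qed

text \<open>The representatives are arbitrary choices, so \<open>\<one>\<close> need not be among
  them. Nonemptiness serves the unions formed with \<open>in_class_UN\<close>.\<close>

lemma finite_transversal:
  assumes "subgroup N G" "finite (rcosets N)"
  obtains T where "finite T" "T \<noteq> {}" "T \<subseteq> carrier G" "(\<Union>t\<in>T. N #> t) = carrier G"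
proof -
  have N: "N \<subseteq> carrier G" using assms(1) by (rule subgroup.subset)
  define r where "r c = (SOME x. x \<in> carrier G \<and> c = N #> x)" for c
  have r: "r c \<in> carrier G" "N #> r c = c" if "c \<in> rcosets N" for c
  proof -
    have "\<exists>x. x \<in> carrier G \<and> c = N #> x" using that by (auto simp: RCOSETS_def)
    from someI_ex[OF this] show "r c \<in> carrier G" "N #> r c = c" by (auto simp: r_def)
  qed
  let ?T = "r ` (rcosets N)"
  have "x \<in> (\<Union>t\<in>?T. N #> t)" if "x \<in> carrier G" for x
  proof -
    have c: "N #> x \<in> rcosets N" using that N by (rule rcosetsI[rotated])
    have "x \<in> N #> r (N #> x)" using r(2)[OF c] rcos_self[OF that assms(1)] by simp
    with c show ?thesis by blast
  qed
  moreover have "N #> t \<subseteq> carrier G" if "t \<in> ?T" for t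
    using that r(1) r_coset_subset_G[OF N] by blast
  moreover have "?T \<noteq> {}"
    using rcosetsI[OF N one_closed] by blast
  ultimately show thesis
    using that[of ?T] assms(2) r(1) by blast
qed

text \<open>Schreier's lemma: carrying a coset representative along a word turns its letters into
  elements \<open>t a t'\<inverse>\<close> of the subgroup.\<close>

lemma finite_index_finitely_generated:
  assumes N: "subgroup N G" "finite (rcosets N)"
    and A: "finite A" "A \<subseteq> carrier G" "word_eval G ` lists A = carrier G"
  obtains Y where "finite Y" "Y \<subseteq> N" "word_eval G ` lists Y = N"
proof -
  obtain T where T: "finite T" "T \<subseteq> carrier G" "(\<Union>t\<in>T. N #> t) = carrier G"
    using finite_transversal[OF N] by metis
  \<comment> \<open>The first set holds the Schreier elements. As \<open>\<one>\<close> need not be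
    in \<open>T\<close>, the run for an element of \<open>N\<close> starts and ends at
    representatives of the coset \<open>N\<close>; the elements of \<open>T\<close> in
    \<open>N\<close> and their inverses correct for these. Since \<open>A\<close> generates
    \<open>G\<close> as a monoid, inverses of Schreier elements need not be added.\<close>
  define Y where
    "Y = N \<inter> ((\<lambda>(t, a, t'). t \<otimes> a \<otimes> inv t') ` (T \<times> A \<times> T) \<union> T \<union> m_inv G ` T)"
  have fin: "finite Y"
    unfolding Y_def using A(1) T(1) by (intro finite_Int disjI2) auto
  have YN: "Y \<subseteq> N" by (auto simp: Y_def)
  then have YG: "lists Y \<subseteq> lists (carrier G)" using subgroup.subset[OF N(1)] by blast
  have cover: "\<exists>t\<in>T. x \<otimes> inv t \<in> N" if "x \<in> carrier G" for x
    using that T(2,3) subgroup.rcos_module_imp[OF N(1) group_axioms] by blast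
  have run: "\<exists>t'\<in>T. \<exists>y\<in>lists Y. t \<otimes> word_eval G w = word_eval G y \<otimes> t'"
    if "w \<in> lists A" "t \<in> T" for t w
    using that
  proof (induction w arbitrary: t)
    case Nil
    then show ?case using T(2) by (intro bexI[of _ t] bexI[of _ "[]"]) auto
  next
    case (Cons a w)
    then have a: "a \<in> A" "a \<in> carrier G" "t \<in> carrier G" "w \<in> lists A" "w \<in> lists (carrier G)"
      using A(2) T(2) by auto
    then obtain s where s: "s \<in> T" "t \<otimes> a \<otimes> inv s \<in> N" using cover[of "t \<otimes> a"] by auto
    then have b: "t \<otimes> a \<otimes> inv s \<in> Y" using Cons.prems a(1) by (force simp: Y_def)
    obtain t' y where y: "t' \<in> T" "y \<in> lists Y" "s \<otimes> word_eval G w = word_eval G y \<otimes> t'"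
      using Cons.IH s(1) a(4) by blast
    have cl: "s \<in> carrier G" "t' \<in> carrier G" "y \<in> lists (carrier G)"
      using s(1) y(1,2) T(2) YG by auto
    have "t \<otimes> word_eval G (a # w) = t \<otimes> a \<otimes> inv s \<otimes> (s \<otimes> word_eval G w)"
      using a cl by (simp add: m_assoc)
    also have "\<dots> = word_eval G ((t \<otimes> a \<otimes> inv s) # y) \<otimes> t'"
      using a cl y(3) by (simp add: m_assoc)
    finally show ?case using b y by (intro bexI[of _ t'] bexI[of _ "_ # y"]) auto
  qed
  have "x \<in> word_eval G ` lists Y" if x: "x \<in> N" for x
  proof -
    have xG: "x \<in> carrier G" using x subgroup.subset[OF N(1)] by blast
    obtain w where w: "w \<in> lists A" "x = word_eval G w" using xG A(3) by blast
    obtain t0 where t0: "t0 \<in> T" "inv t0 \<in> N" using cover[of \<one>] T(2) by force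
    then have t0G: "t0 \<in> carrier G" and t0N: "t0 \<in> N"
      using T(2) subgroup.m_inv_closed[OF N(1) t0(2)] by auto
    obtain t y where y: "t \<in> T" "y \<in> lists Y" "t0 \<otimes> x = word_eval G y \<otimes> t"
      using run[OF w(1) t0(1)] w(2) by auto
    have yG: "y \<in> lists (carrier G)" "t \<in> carrier G" using y YG T(2) by auto
    have "word_eval G y \<in> N" using word_eval_in_subgroup[OF N(1)] y(2) YN by blast
    \<comment> \<open>For \<open>x\<close> in \<open>N\<close> the run returns to the coset
      \<open>N\<close>, so its last representative lies in \<open>N\<close> and is itself a letter
      of \<open>Y\<close>.\<close>
    moreover have "t = inv (word_eval G y) \<otimes> (t0 \<otimes> x)"
      using yG t0G xG by (simp add: y(3) flip: m_assoc)
    ultimately have "t \<in> N"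
      using x t0N N(1) by (simp add: subgroup.m_closed subgroup.m_inv_closed)
    then have "inv t0 \<in> Y" "t \<in> Y" using t0 y(1) by (auto simp: Y_def)
    moreover have "x = word_eval G (inv t0 # y @ [t])"
    proof -
      have "x = inv t0 \<otimes> (t0 \<otimes> x)" using t0G xG by (simp flip: m_assoc)
      then show ?thesis using yG t0G by (simp add: y(3))
    qed
    ultimately show ?thesis using y(2) by (intro image_eqI[of _ _ "inv t0 # y @ [t]"]) auto
  qed
  moreover have "word_eval G ` lists Y \<subseteq> N"
    using word_eval_in_subgroup[OF N(1)] YN by blast
  ultimately show thesis using that[OF fin YN] by blast
qed

text \<open>Choose finitely many words over \<open>A\<close> that spell the values of
  \<open>\<phi>\<close> on \<open>Y\<close>. Their star evaluates to the whole image because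
  \<open>Y\<close> generates \<open>N\<close> as a monoid and \<open>\<phi>\<close> turns products
  over \<open>Y\<close> into products of its values.\<close>

lemma hom_image_as_star:
  assumes N: "subgroup N G"
    and Y: "finite Y" "Y \<subseteq> N" "word_eval G ` lists Y = N"
    and A: "A \<subseteq> carrier G" "word_eval G ` lists A = carrier G"
    and \<phi>: "\<phi> \<in> hom (G\<lparr>carrier := N\<rparr>) G"
  obtains K where "finite K" "K \<subseteq> lists A" "(\<lambda>y. word_eval G (concat y)) ` lists K = \<phi> ` N"
proof -
  interpret \<phi>: group_hom "G\<lparr>carrier := N\<rparr>" G \<phi>
    using subgroup_imp_group[OF N] \<phi> by (simp add: group_hom_def group_hom_axioms_def group_axioms)
  have eval: "word_eval G (map \<phi> y) = \<phi> (word_eval G y)" if "y \<in> lists N" for y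
    using that \<phi>.hom_one \<phi>.hom_mult word_eval_in_subgroup[OF N] by (induction y) auto
  have "\<phi> ` Y \<subseteq> word_eval G ` lists A"
    using A(2) Y(2) \<phi>.hom_closed by auto
  then obtain K where K: "K \<subseteq> lists A" "finite K" "\<phi> ` Y = word_eval G ` K"
    using finite_subset_image[of "\<phi> ` Y"] Y(1) by (metis finite_imageI)
  have "lists K \<subseteq> lists (lists (carrier G))" using K(1) A(1) by blast
  then have "(\<lambda>y. word_eval G (concat y)) ` lists K = word_eval G ` map (word_eval G) ` lists K"
    unfolding image_image by (intro image_cong refl word_eval_concat) blast
  also have "\<dots> = word_eval G ` map \<phi> ` lists Y"
    by (simp flip: lists_image add: K(3))
  also have "\<dots> = \<phi> ` word_eval G ` lists Y"
    unfolding image_image using Y(2) by (intro image_cong refl eval) blast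
  finally show thesis using that[OF K(2,1)] Y(3) by simp
qed

text \<open>The coset automaton: its states are the finitely many right cosets of \<open>N\<close>,
  on which letters act by right multiplication, so the run from \<open>N\<close> on a word ends in
  the coset of its value.\<close>

lemma in_class_coset:
  assumes "lang_cone C" "in_class C A L" "finite A" "A \<subseteq> carrier G"
    and N: "subgroup N G" "finite (rcosets N)" and t: "t \<in> carrier G"
  shows "in_class C A {w \<in> L. word_eval G w \<in> N #> t}"
proof -
  have NG: "N \<subseteq> carrier G" using N(1) by (rule subgroup.subset)
  have run: "foldl (#>) (N #> x) w = N #> (x \<otimes> word_eval G w)"
    if "w \<in> lists A" "x \<in> carrier G" for x w
    using that
  proof (induction w arbitrary: x)
    case (Cons a w)
    then have "a \<in> carrier G" "w \<in> lists (carrier G)" using assms(4) by auto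
    with Cons NG show ?case by (simp add: coset_mult_assoc m_assoc)
  qed simp
  have "in_class C A {w \<in> L. foldl (#>) (N #> \<one>) w \<in> {N #> t}}"
  proof (rule in_class_Int_automaton[OF assms(1-3) N(2)])
    show "N #> \<one> \<in> rcosets N" using NG by (intro rcosetsI) auto
    show "q #> a \<in> rcosets N" if "q \<in> rcosets N" "a \<in> A" for q a
      using that NG assms(4) by (auto simp: RCOSETS_def coset_mult_assoc subset_iff)
  qed
  moreover have "foldl (#>) (N #> \<one>) w \<in> {N #> t} \<longleftrightarrow> word_eval G w \<in> N #> t" if "w \<in> L" for w
  proof -
    have w: "w \<in> lists A" using that assms(2) by (auto simp: in_class_def)
    then have "word_eval G w \<in> carrier G" using assms(4) by (intro word_eval_closed) blast
    then show ?thesis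
      using run[OF w, of \<one>] repr_independence[OF _ t N(1)] rcos_self[OF _ N(1)] by auto
  qed
  then have "{w \<in> L. foldl (#>) (N #> \<one>) w \<in> {N #> t}} = {w \<in> L. word_eval G w \<in> N #> t}" by blast
  ultimately show ?thesis by simp
qed

section \<open>Conjugacy classes\<close>

text \<open>The commutator in the convention for which
  \<open>inv m \<otimes> t \<otimes> m = t \<otimes> comm_map t m\<close>: conjugation by
  \<open>m\<close> becomes multiplication on the right.\<close>

definition comm_map :: "'a \<Rightarrow> 'a \<Rightarrow> 'a" where
  "comm_map t m = inv t \<otimes> inv m \<otimes> t \<otimes> m"

text \<open>Write the value at \<open>m\<close> as
  \<open>(inv t \<otimes> inv m \<otimes> t) \<otimes> m\<close>. By normality both factors lie in
  \<open>N\<close>, and each is a homomorphism in \<open>m\<close> because \<open>N\<close> is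
  abelian; a pointwise product of homomorphisms into an abelian group is again one.\<close>

lemma comm_map_hom:
  assumes N: "N \<lhd> G" and comm: "\<And>x y. x \<in> N \<Longrightarrow> y \<in> N \<Longrightarrow> x \<otimes> y = y \<otimes> x"
    and t: "t \<in> carrier G"
  shows "comm_map t \<in> hom (G\<lparr>carrier := N\<rparr>) G"
proof -
  have NG: "N \<subseteq> carrier G" using normal_imp_subgroup[OF N] by (rule subgroup.subset)
  have "comm_map t (x \<otimes> y) = comm_map t x \<otimes> comm_map t y" if x: "x \<in> N" and y: "y \<in> N" for x y
  proof -
    have xy: "x \<in> carrier G" "y \<in> carrier G" using x y NG by auto
    define p q where "p = inv t \<otimes> inv x \<otimes> t" and "q = inv t \<otimes> inv y \<otimes> t"
    have iN: "inv x \<in> N" "inv y \<in> N"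
      using x y normal_imp_subgroup[OF N] by (simp_all add: subgroup.m_inv_closed)
    have pq: "p \<in> N" "q \<in> N" "p \<in> carrier G" "q \<in> carrier G"
      using iN t xy normal.inv_op_closed1[OF N t] by (auto simp: p_def q_def)
    have "comm_map t (x \<otimes> y) = q \<otimes> p \<otimes> (x \<otimes> y)"
      using xy t by (simp add: comm_map_def p_def q_def m_assoc inv_mult_group)
    also have "\<dots> = p \<otimes> (q \<otimes> x) \<otimes> y"
      using pq xy comm[OF pq(1,2)] by (simp flip: m_assoc)
    also have "\<dots> = p \<otimes> (x \<otimes> q) \<otimes> y"
      using comm[OF pq(2) x] by simp
    also have "\<dots> = comm_map t x \<otimes> comm_map t y"
      using pq xy by (simp add: comm_map_def p_def q_def m_assoc)
    finally show ?thesis .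
  qed
  then show ?thesis using NG t by (auto simp: hom_def comm_map_def)
qed

text \<open>Every group element is \<open>m \<otimes> s\<close> with \<open>m\<close> in
  \<open>N\<close> and \<open>s\<close> in \<open>T\<close>. When \<open>x = n \<otimes> t\<close>
  is conjugated by \<open>m\<close>, the factor \<open>inv m\<close> commutes past \<open>n\<close>,
  which leaves a right multiplication by \<open>comm_map t m\<close>, the same for all of
  \<open>N #> t\<close>.\<close>

lemma conj_coset:
  assumes N: "N \<lhd> G" and comm: "\<And>x y. x \<in> N \<Longrightarrow> y \<in> N \<Longrightarrow> x \<otimes> y = y \<otimes> x"
    and T: "T \<subseteq> carrier G" "(\<Union>t\<in>T. N #> t) = carrier G"
    and t: "t \<in> carrier G" and x: "x \<in> N #> t"
  shows "(\<lambda>g. inv g \<otimes> x \<otimes> g) ` carrier G =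
    (\<lambda>(s, k). inv s \<otimes> x \<otimes> k \<otimes> s) ` (T \<times> comm_map t ` N)"
proof -
  have NG: "N \<subseteq> carrier G" using normal_imp_subgroup[OF N] by (rule subgroup.subset)
  obtain n where n: "n \<in> N" "x = n \<otimes> t" using x by (auto simp: r_coset_def)
  have conj: "inv (m \<otimes> s) \<otimes> x \<otimes> (m \<otimes> s) = inv s \<otimes> x \<otimes> comm_map t m \<otimes> s"
    if m: "m \<in> N" and s: "s \<in> T" for m s
  proof -
    have G: "n \<in> carrier G" "m \<in> carrier G" "s \<in> carrier G" using m s n NG T by auto
    have mN: "inv m \<in> N" using m normal_imp_subgroup[OF N] by (simp add: subgroup.m_inv_closed)
    have "inv (m \<otimes> s) \<otimes> x \<otimes> (m \<otimes> s) = inv s \<otimes> (inv m \<otimes> n) \<otimes> t \<otimes> m \<otimes> s"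
      using G t by (simp add: n(2) m_assoc inv_mult_group)
    also have "\<dots> = inv s \<otimes> (n \<otimes> inv m) \<otimes> t \<otimes> m \<otimes> s"
      using comm[OF mN n(1)] by simp
    also have "\<dots> = inv s \<otimes> x \<otimes> comm_map t m \<otimes> s"
      using G t by (simp add: n(2) m_assoc comm_map_def)
    finally show ?thesis .
  qed
  have "carrier G = (\<lambda>(s, m). m \<otimes> s) ` (T \<times> N)"
    unfolding T(2)[symmetric] r_coset_def by force
  then have "(\<lambda>g. inv g \<otimes> x \<otimes> g) ` carrier G =
      (\<lambda>(s, m). inv (m \<otimes> s) \<otimes> x \<otimes> (m \<otimes> s)) ` (T \<times> N)"
    by (simp add: image_image case_prod_unfold)
  also have "\<dots> = (\<lambda>(s, m). inv s \<otimes> x \<otimes> comm_map t m \<otimes> s) ` (T \<times> N)"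
    by (intro image_cong refl) (auto simp: conj)
  also have "\<dots> = (\<lambda>(s, k). inv s \<otimes> x \<otimes> k \<otimes> s) ` (T \<times> comm_map t ` N)"
    by force
  finally show ?thesis .
qed

lemma conj_closure_eq: "conj_closure G U = (\<Union>u\<in>U. (\<lambda>g. inv g \<otimes> u \<otimes> g) ` carrier G)"
  by (auto simp: conj_closure_def)

text \<open>Conjugacy is symmetric, so \<open>x\<close> can be tested by its own conjugates rather
  than by those of members of \<open>U\<close>; full preimages call for this form.\<close>

lemma mem_conj_closure_iff:
  assumes "U \<subseteq> carrier G"
  shows "x \<in> conj_closure G U \<longleftrightarrow> x \<in> carrier G \<and> (\<exists>g\<in>carrier G. inv g \<otimes> x \<otimes> g \<in> U)"
proof
  assume "x \<in> conj_closure G U"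
  then obtain g u where gu: "g \<in> carrier G" "u \<in> U" "x = inv g \<otimes> u \<otimes> g"
    by (auto simp: conj_closure_def)
  with assms have "u \<in> carrier G" by blast
  with gu have "inv (inv g) \<otimes> x \<otimes> inv g = u" by (simp add: m_assoc)
  with gu \<open>u \<in> carrier G\<close> show "x \<in> carrier G \<and> (\<exists>g\<in>carrier G. inv g \<otimes> x \<otimes> g \<in> U)"
    by (metis inv_closed m_closed)
next
  assume "x \<in> carrier G \<and> (\<exists>g\<in>carrier G. inv g \<otimes> x \<otimes> g \<in> U)"
  then obtain g where g: "x \<in> carrier G" "g \<in> carrier G" "inv g \<otimes> x \<otimes> g \<in> U" by blast
  then have "x = inv (inv g) \<otimes> (inv g \<otimes> x \<otimes> g) \<otimes> inv g" by (simp add: m_assoc)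
  with g show "x \<in> conj_closure G U"
    unfolding conj_closure_def by (intro UN_I[of "inv g"] image_eqI[of _ _ "inv g \<otimes> x \<otimes> g"]) auto
qed

text \<open>The two cases use the same rational description of the conjugacy classes: \<open>u s\<close> and \<open>v s\<close>
  spell \<open>s\<inverse>\<close> and \<open>s\<close>, and the star of the finite set \<open>K t\<close> of words spells \<open>comm_map t ` N\<close>.\<close>

lemma rational_conjugacy:
  assumes A: "finite A" "A \<subseteq> carrier G" "word_eval G ` lists A = carrier G"
    and va: "virtually_abelian G"
  obtains N T K u v where "subgroup N G" "finite (rcosets N)"
    "finite T" "T \<noteq> {}" "T \<subseteq> carrier G" "(\<Union>t\<in>T. N #> t) = carrier G"
    "\<forall>t\<in>T. finite (K t) \<and> K t \<subseteq> lists A"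
    "\<forall>s\<in>T. u s \<in> lists A \<and> v s \<in> lists A"
    "\<forall>t\<in>T. \<forall>w\<in>lists A. word_eval G w \<in> N #> t \<longrightarrow>
      (\<lambda>g. inv g \<otimes> word_eval G w \<otimes> g) ` carrier G =
      (\<lambda>(s, y). word_eval G (u s @ w @ concat y @ v s)) ` (T \<times> lists (K t))"
proof -
  obtain H where H: "subgroup H G" "finite (rcosets H)" "comm_group (G\<lparr>carrier := H\<rparr>)"
    using va by (auto simp: virtually_abelian_def)
  obtain N where N: "N \<lhd> G" "N \<subseteq> H" "finite (rcosets N)"
    using finite_index_normal_core[OF H(1,2)] .
  have sub: "subgroup N G" using N(1) by (rule normal_imp_subgroup)
  have comm: "x \<otimes> y = y \<otimes> x" if "x \<in> N" "y \<in> N" for x y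
    
  proof -
    interpret H: comm_group "G\<lparr>carrier := H\<rparr>" by (rule H(3))
    show ?thesis using H.m_comm[of x y] that N(2) by auto
  qed
  obtain T where T: "finite T" "T \<noteq> {}" "T \<subseteq> carrier G" "(\<Union>t\<in>T. N #> t) = carrier G"
    using finite_transversal[OF sub N(3)] .
  obtain Y where Y: "finite Y" "Y \<subseteq> N" "word_eval G ` lists Y = N"
    using finite_index_finitely_generated[OF sub N(3) A] .
  have "\<exists>K. finite K \<and> K \<subseteq> lists A \<and>
      (\<lambda>y. word_eval G (concat y)) ` lists K = comm_map t ` N" if "t \<in> T" for t
    using hom_image_as_star[OF sub Y A(2,3) comm_map_hom[OF N(1) comm]] T(3) that
    by (metis subset_iff)
  then obtain K where K: "\<And>t. t \<in> T \<Longrightarrow> finite (K t) \<and> K t \<subseteq> lists A"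
    "\<And>t. t \<in> T \<Longrightarrow> (\<lambda>y. word_eval G (concat y)) ` lists (K t) = comm_map t ` N"
    by metis
  \<comment> \<open>\<open>v\<close> spells every group element; the prefix \<open>u s\<close> will
    be \<open>v (inv s)\<close>.\<close>
  obtain v where v: "\<And>g. g \<in> carrier G \<Longrightarrow> v g \<in> lists A \<and> word_eval G (v g) = g"
    using A(3) by (metis image_iff)
  have "(\<lambda>g. inv g \<otimes> word_eval G w \<otimes> g) ` carrier G =
      (\<lambda>(s, y). word_eval G (v (inv s) @ w @ concat y @ v s)) ` (T \<times> lists (K t))"
    if t: "t \<in> T" and w: "w \<in> lists A" "word_eval G w \<in> N #> t" for t w
  proof -
    have "word_eval G (v (inv s) @ w @ concat y @ v s) =
        inv s \<otimes> word_eval G w \<otimes> word_eval G (concat y) \<otimes> s"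
      if "s \<in> T" "y \<in> lists (K t)" for s y
    proof -
      have s: "s \<in> carrier G" using that T(3) by blast
      have "concat y \<in> lists A" using concat_in_lists[OF that(2)] K(1)[OF t] by blast
      moreover have "lists A \<subseteq> lists (carrier G)" using A(2) by blast
      ultimately have "w \<in> lists (carrier G)" "concat y \<in> lists (carrier G)"
        "v s \<in> lists (carrier G)" "v (inv s) \<in> lists (carrier G)"
        using w(1) v s by (auto simp del: in_lists_conv_set)
      then show ?thesis using v[of s] v[of "inv s"] s by (simp add: m_assoc)
    qed
    then have "(\<lambda>(s, y). word_eval G (v (inv s) @ w @ concat y @ v s)) ` (T \<times> lists (K t)) =
        (\<lambda>(s, y). inv s \<otimes> word_eval G w \<otimes> word_eval G (concat y) \<otimes> s) ` (T \<times> lists (K t))"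
      by (intro image_cong refl) auto
    \<comment> \<open>Only the values of the words in the star enter, so it may be replaced by the
      image of \<open>N\<close> under \<open>comm_map t\<close>.\<close>
    also have "\<dots> = (\<lambda>(s, k). inv s \<otimes> word_eval G w \<otimes> k \<otimes> s) ` (T \<times> comm_map t ` N)"
      unfolding K(2)[OF t, symmetric] by force
    finally show ?thesis
      using conj_coset[OF N(1) comm T(3,4) subsetD[OF T(3) t] w(2)] by (simp only:)
  qed
  moreover have "\<forall>s\<in>T. v (inv s) \<in> lists A \<and> v s \<in> lists A"
    using v T(3) by blast
  moreover have "\<forall>t\<in>T. finite (K t) \<and> K t \<subseteq> lists A"
    using K(1) by blast
  ultimately show thesis
    by (intro that[OF sub N(3) T, of K "\<lambda>s. v (inv s)" v]) blast+
qed

end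

section \<open>Closure under conjugation for full preimages and for images\<close>

theorem theorem7p4:
  fixes C :: "nat list set set"
    and G :: "('a, 'b) monoid_scheme"
    and Gen U :: "'a set"
  assumes "full_semi_AFL C"
    and "group G"
    and "finite Gen" and "Gen \<subseteq> carrier G" and "generate G Gen = carrier G"
    and "virtually_abelian G"
    and "U \<subseteq> carrier G"
  shows "(U \<in> class_forall C G Gen \<longrightarrow> conj_closure G U \<in> class_forall C G Gen) \<and>
         (U \<in> class_exists C G Gen \<longrightarrow> conj_closure G U \<in> class_exists C G Gen)"
proof -
  interpret group G by fact
  have cone: "lang_cone C" using assms(1) by (simp add: full_semi_AFL_def)
  define A where "A = sym_gens G Gen"
  have A: "finite A" "A \<subseteq> carrier G" "word_eval G ` lists A = carrier G"
    using assms(3) sym_gens_closed[OF assms(4)] word_eval_surj[OF assms(4,5)]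
    by (simp_all add: A_def) (simp add: sym_gens_def)
  obtain N T K u v where N: "subgroup N G" "finite (rcosets\<^bsub>G\<^esub> N)"
    and T: "finite T" "T \<noteq> {}" "T \<subseteq> carrier G" "(\<Union>t\<in>T. N #>\<^bsub>G\<^esub> t) = carrier G"
    and K: "\<forall>t\<in>T. finite (K t) \<and> K t \<subseteq> lists A"
    and uv: "\<forall>s\<in>T. u s \<in> lists A \<and> v s \<in> lists A"
    and conj_words: "\<forall>t\<in>T. \<forall>w\<in>lists A. word_eval G w \<in> N #>\<^bsub>G\<^esub> t \<longrightarrow>
      (\<lambda>g. inv\<^bsub>G\<^esub> g \<otimes>\<^bsub>G\<^esub> word_eval G w \<otimes>\<^bsub>G\<^esub> g) ` carrier G =
      (\<lambda>(s, y). word_eval G (u s @ w @ concat y @ v s)) ` (T \<times> lists (K t))"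
    using rational_conjugacy[OF A assms(6)] .
  note conj = conj_words[rule_format]
  have cover: "\<exists>t\<in>T. word_eval G w \<in> N #>\<^bsub>G\<^esub> t" if "w \<in> lists A" for w
    using T(4) A(3) that by blast
  have TT: "finite (T \<times> T)" "T \<times> T \<noteq> {}" using T(1,2) by auto
  have closed: "conj_closure G U \<subseteq> carrier G"
    using mem_conj_closure_iff[OF assms(7)] by blast
  have UN: "in_class C A (\<Union>(s, t)\<in>T \<times> T. M s t)"
    if "\<And>s t. s \<in> T \<Longrightarrow> t \<in> T \<Longrightarrow> in_class C A (M s t)" for M
    using that by (intro in_class_UN[OF assms(1) TT]) auto
  have uvK: "K t \<subseteq> lists A" "finite (K t)" "u s \<in> lists A" "v s \<in> lists A"
    if "s \<in> T" "t \<in> T" for s t using that K uv by auto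
  have fa: "conj_closure G U \<in> class_forall C G Gen" if "U \<in> class_forall C G Gen"
  proof -
    let ?P = "{w \<in> lists A. word_eval G w \<in> U}"
    \<comment> \<open>The coset condition comes last here: \<open>K t\<close> must match the coset
      of the stripped word, which is the one tested for the closure, and not that of the framed word
      with value in \<open>U\<close>.\<close>
    define M where "M s t = {w \<in> {x \<in> lists A. \<exists>y\<in>lists (K t). u s @ x @ concat y @ v s \<in> ?P}.
      word_eval G w \<in> N #>\<^bsub>G\<^esub> t}" for s t
    have P: "in_class C A ?P" using that by (simp add: class_forall_def A_def)
    have "in_class C A (\<Union>(s, t)\<in>T \<times> T. M s t)"
      unfolding M_def
      by (intro UN in_class_coset[OF cone _ A(1,2) N] in_class_unframe[OF cone P A(1)])
        (use uvK T(3) in auto)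
    moreover have "(\<Union>(s, t)\<in>T \<times> T. M s t) = {w \<in> lists A. word_eval G w \<in> conj_closure G U}"
    proof -
      have spelled: "u s @ w @ concat y @ v s \<in> lists A"
        if "w \<in> lists A" "s \<in> T" "t \<in> T" "y \<in> lists (K t)" for s t w y
        using that uvK[of s t] concat_in_lists[of y "K t" A] by (auto simp del: set_concat)
      \<comment> \<open>As \<open>?P\<close> is the full preimage of \<open>U\<close>, a framed word
        lies in it exactly when its value lies in \<open>U\<close>; by \<open>conj\<close> these
        values run through the conjugates of the value of \<open>w\<close>.\<close>
      have iff: "word_eval G w \<in> conj_closure G U \<longleftrightarrow> (\<exists>s\<in>T. w \<in> M s t)"
        if w: "w \<in> lists A" and t: "t \<in> T" "word_eval G w \<in> N #>\<^bsub>G\<^esub> t" for w t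
      proof -
        have "word_eval G w \<in> carrier G" using w A(3) by blast
        then have "word_eval G w \<in> conj_closure G U \<longleftrightarrow>
            (\<exists>x\<in>(\<lambda>g. inv\<^bsub>G\<^esub> g \<otimes>\<^bsub>G\<^esub> word_eval G w \<otimes>\<^bsub>G\<^esub> g) ` carrier G. x \<in> U)"
          by (simp add: mem_conj_closure_iff[OF assms(7)])
        also have "\<dots> \<longleftrightarrow> (\<exists>s\<in>T. \<exists>y\<in>lists (K t). word_eval G (u s @ w @ concat y @ v s) \<in> U)"
          unfolding conj[OF t(1) w t(2)] by (simp add: Bex_def)
        also have "\<dots> \<longleftrightarrow> (\<exists>s\<in>T. w \<in> M s t)"
          unfolding M_def mem_Collect_eq using spelled[OF w _ t(1)] w t(2) by blast
        finally show ?thesis .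
      qed
      have M: "w \<in> lists A" "word_eval G w \<in> N #>\<^bsub>G\<^esub> t" if "w \<in> M s t" for w s t
        using that by (simp_all add: M_def)
      show ?thesis
      proof (intro equalityI subsetI)
        fix w assume "w \<in> (\<Union>(s, t)\<in>T \<times> T. M s t)"
        then obtain s t where "s \<in> T" "t \<in> T" "w \<in> M s t" by blast
        with iff M show "w \<in> {w \<in> lists A. word_eval G w \<in> conj_closure G U}" by blast
      next
        fix w assume "w \<in> {w \<in> lists A. word_eval G w \<in> conj_closure G U}"
        moreover from this obtain t where "t \<in> T" "word_eval G w \<in> N #>\<^bsub>G\<^esub> t"
          using cover by blast
        ultimately show "w \<in> (\<Union>(s, t)\<in>T \<times> T. M s t)" using iff by blast
      qed
    qed
    ultimately show ?thesis using closed by (simp add: class_forall_def A_def)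
  qed
  have ex: "conj_closure G U \<in> class_exists C G Gen" if UE: "U \<in> class_exists C G Gen"
  proof -
    obtain L where L: "in_class C A L" "word_eval G ` L = U"
      using UE unfolding class_exists_def A_def by blast
    have LA: "L \<subseteq> lists A" using L(1) by (simp add: in_class_def)
    \<comment> \<open>Here the coset condition comes first: \<open>w\<close> is a word for a member
      of \<open>U\<close>, and its coset decides which \<open>K t\<close> to attach.\<close>
    define M where "M s t = {u s @ w @ concat y @ v s | w y.
      w \<in> {w \<in> L. word_eval G w \<in> N #>\<^bsub>G\<^esub> t} \<and> y \<in> lists (K t)}" for s t
    have "in_class C A (\<Union>(s, t)\<in>T \<times> T. M s t)"
      unfolding M_def
      by (intro UN in_class_frame[OF cone in_class_coset[OF cone L(1) A(1,2) N] A(1)])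
        (use uvK T(3) in auto)
    moreover have "word_eval G ` (\<Union>(s, t)\<in>T \<times> T. M s t) = conj_closure G U"
    proof (rule Set.set_eqI)
      fix x
      have "x \<in> conj_closure G U \<longleftrightarrow>
          (\<exists>w\<in>L. x \<in> (\<lambda>g. inv\<^bsub>G\<^esub> g \<otimes>\<^bsub>G\<^esub> word_eval G w \<otimes>\<^bsub>G\<^esub> g) ` carrier G)"
        unfolding conj_closure_eq L(2)[symmetric] by blast
      \<comment> \<open>The coset of the value of \<open>w\<close> is made explicit, because the
        words that spell its conjugacy class depend on \<open>t\<close>.\<close>
      also have "\<dots> \<longleftrightarrow> (\<exists>w\<in>L. \<exists>t\<in>T. word_eval G w \<in> N #>\<^bsub>G\<^esub> t \<and>
          x \<in> (\<lambda>g. inv\<^bsub>G\<^esub> g \<otimes>\<^bsub>G\<^esub> word_eval G w \<otimes>\<^bsub>G\<^esub> g) ` carrier G)"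
        using cover subsetD[OF LA] by meson
      also have "\<dots> \<longleftrightarrow> (\<exists>w\<in>L. \<exists>t\<in>T. word_eval G w \<in> N #>\<^bsub>G\<^esub> t \<and>
          x \<in> (\<lambda>(s, y). word_eval G (u s @ w @ concat y @ v s)) ` (T \<times> lists (K t)))"
        by (intro bex_cong refl conj_cong) (simp only: conj subsetD[OF LA])
      also have "\<dots> \<longleftrightarrow> (\<exists>w\<in>L. \<exists>t\<in>T. word_eval G w \<in> N #>\<^bsub>G\<^esub> t \<and>
          (\<exists>s\<in>T. \<exists>y\<in>lists (K t). x = word_eval G (u s @ w @ concat y @ v s)))"
        by (simp add: image_iff Bex_def)
      also have "\<dots> \<longleftrightarrow> x \<in> word_eval G ` (\<Union>(s, t)\<in>T \<times> T. M s t)"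
      proof
        assume "\<exists>w\<in>L. \<exists>t\<in>T. word_eval G w \<in> N #>\<^bsub>G\<^esub> t \<and>
          (\<exists>s\<in>T. \<exists>y\<in>lists (K t). x = word_eval G (u s @ w @ concat y @ v s))"
        then obtain w t s y where "w \<in> L" "t \<in> T" "word_eval G w \<in> N #>\<^bsub>G\<^esub> t" "s \<in> T"
          "y \<in> lists (K t)" and x: "x = word_eval G (u s @ w @ concat y @ v s)" by blast
        then have "u s @ w @ concat y @ v s \<in> M s t" unfolding M_def by blast
        with x \<open>s \<in> T\<close> \<open>t \<in> T\<close> show "x \<in> word_eval G ` (\<Union>(s, t)\<in>T \<times> T. M s t)" by blast
      next
        assume "x \<in> word_eval G ` (\<Union>(s, t)\<in>T \<times> T. M s t)"
        then obtain s t z where "s \<in> T" "t \<in> T" "z \<in> M s t" "x = word_eval G z" by blast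
        then show "\<exists>w\<in>L. \<exists>t\<in>T. word_eval G w \<in> N #>\<^bsub>G\<^esub> t \<and>
          (\<exists>s\<in>T. \<exists>y\<in>lists (K t). x = word_eval G (u s @ w @ concat y @ v s))"
          unfolding M_def by blast
      qed
      finally show "x \<in> word_eval G ` (\<Union>(s, t)\<in>T \<times> T. M s t) \<longleftrightarrow> x \<in> conj_closure G U" ..
    qed
    ultimately show ?thesis using closed by (auto simp: class_exists_def A_def)
  qed
  from fa ex show ?thesis by blast
qed

end
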